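(* Let $G$ be a finite group and let $\Sigma:=\bigsqcup_{(H)\in\mathcal{C}(G)} G/H$ be the $G$-set that is the disjoint union of the transitive $G$-sets $G/H$, with one representative $H$ taken from each conjugacy class $(H)$ of subgroups of $G$. Then $\Gamma[\Sigma]=\Gamma(G)$.
   Context: For a group $G$, the intersection graph $\Gamma(G)$ is the simple undirected graph whose vertices are the proper non-trivial subgroups of $G$, with two distinct vertices $H,K$ adjacent if and only if $H\cap K\neq 1$. For a finite group $G$ and a $G$-set $\Omega$, the intersection graph $\Gamma[\Omega]$ of $\Omega$ is the simple graph whose vertex set is the set of proper non-trivial subgroups of $G$ that occur as stabilizers of points of $\Omega$, with two distinct stabilizers adjacent if and only if their intersection is non-trivial. $\mathcal{C}(G)$ is the set of conjugacy classes of subgroups of $G$, $(H)$ is the conjugacy class of $H$, and $G/H$ is the left coset space with its left $G$-action (the paper writes $[G/H]$ for its isomorphism class). *)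

theory Defs
  imports "HOL-Algebra.Group_Action" "HOL-Algebra.Left_Coset" "Graph_Theory.Pair_Digraph"
begin

text \<open>
  A simple undirected graph is a symmetric loop-free digraph without parallel arcs
  (locale \<open>pair_graph\<close>): each edge is stored as the two ordered pairs of its endpoints.
  Equality of two such records is equality of the vertex sets and of the edge sets.
\<close>

definition proper_nontrivial_subgroups :: "('a, 'm) monoid_scheme \<Rightarrow> 'a set set" where
  "proper_nontrivial_subgroups G = {H. subgroup H G \<and> H \<noteq> carrier G \<and> H \<noteq> {\<one>\<^bsub>G\<^esub>}}"

definition nontrivial_meet_graph ::
  "('a, 'm) monoid_scheme \<Rightarrow> 'a set set \<Rightarrow> 'a set pair_pre_digraph" where
  "nontrivial_meet_graph G V =
     \<lparr>pverts = V, parcs = {(H, K). H \<in> V \<and> K \<in> V \<and> H \<noteq> K \<and> H \<inter> K \<noteq> {\<one>\<^bsub>G\<^esub>}}\<rparr>"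

definition intersection_graph :: "('a, 'm) monoid_scheme \<Rightarrow> 'a set pair_pre_digraph" where
  "intersection_graph G = nontrivial_meet_graph G (proper_nontrivial_subgroups G)"

text \<open>As in \<^locale>\<open>group_action\<close>, a \<open>G\<close>-set is a set \<open>E\<close> together with an action \<open>\<phi>\<close>.\<close>

definition gset_intersection_graph ::
  "('a, 'm) monoid_scheme \<Rightarrow> 'b set \<Rightarrow> ('a \<Rightarrow> 'b \<Rightarrow> 'b) \<Rightarrow> 'a set pair_pre_digraph" where
  "gset_intersection_graph G E \<phi> =
     nontrivial_meet_graph G {H \<in> proper_nontrivial_subgroups G. \<exists>x\<in>E. H = stabilizer G \<phi> x}"

definition subgroup_conj_classes :: "('a, 'm) monoid_scheme \<Rightarrow> 'a set set set" where
  "subgroup_conj_classes G =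
     orbits G {H. subgroup H G}
       (\<lambda>g. \<lambda>H \<in> {H. subgroup H G}. g <#\<^bsub>G\<^esub> H #>\<^bsub>G\<^esub> (inv\<^bsub>G\<^esub> g))"

text \<open>The restrictions make the action maps extensional, as \<^const>\<open>BijGroup\<close> requires.\<close>

definition coset_action ::
  "('a, 'm) monoid_scheme \<Rightarrow> 'a set \<Rightarrow> 'a \<Rightarrow> 'a set \<Rightarrow> 'a set" where
  "coset_action G H = (\<lambda>g. \<lambda>X \<in> lcosets\<^bsub>G\<^esub> H. g <#\<^bsub>G\<^esub> X)"

definition disjoint_union_action ::
  "'i set \<Rightarrow> ('i \<Rightarrow> 'b set) \<Rightarrow> ('i \<Rightarrow> 'a \<Rightarrow> 'b \<Rightarrow> 'b) \<Rightarrow> 'a \<Rightarrow> 'i \<times> 'b \<Rightarrow> 'i \<times> 'b" where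
  "disjoint_union_action I E \<phi> = (\<lambda>g. \<lambda>p \<in> Sigma I E. (fst p, \<phi> (fst p) g (snd p)))"

text \<open>
  The \<open>G\<close>-set \<open>\<Sigma>\<close>, tagged by conjugacy classes; \<open>rep\<close> selects the representative of each class.
\<close>

definition Sigma_gset ::
  "('a, 'm) monoid_scheme \<Rightarrow> ('a set set \<Rightarrow> 'a set) \<Rightarrow> ('a set set \<times> 'a set) set" where
  "Sigma_gset G rep = (SIGMA C : subgroup_conj_classes G. lcosets\<^bsub>G\<^esub> (rep C))"

definition Sigma_action ::
  "('a, 'm) monoid_scheme \<Rightarrow> ('a set set \<Rightarrow> 'a set) \<Rightarrow> 'a
     \<Rightarrow> 'a set set \<times> 'a set \<Rightarrow> 'a set set \<times> 'a set" where
  "Sigma_action G rep =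
     disjoint_union_action (subgroup_conj_classes G)
       (\<lambda>C. lcosets\<^bsub>G\<^esub> (rep C)) (\<lambda>C. coset_action G (rep C))"

lemma group_actionI:
  assumes G: "group G"
    and ext: "\<And>g. g \<in> carrier G \<Longrightarrow> \<phi> g \<in> extensional E"
    and closed: "\<And>g x. g \<in> carrier G \<Longrightarrow> x \<in> E \<Longrightarrow> \<phi> g x \<in> E"
    and one: "\<And>x. x \<in> E \<Longrightarrow> \<phi> \<one>\<^bsub>G\<^esub> x = x"
    and mult: "\<And>g h x. g \<in> carrier G \<Longrightarrow> h \<in> carrier G \<Longrightarrow> x \<in> E
                 \<Longrightarrow> \<phi> (g \<otimes>\<^bsub>G\<^esub> h) x = \<phi> g (\<phi> h x)"
  shows "group_action G E \<phi>"
proof -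
  interpret group G by (rule G)
  have bij: "\<phi> g \<in> Bij E" if g: "g \<in> carrier G" for g
  proof -
    have "bij_betw (\<phi> g) E E"
    proof (rule bij_betw_byWitness[where f' = "\<phi> (inv\<^bsub>G\<^esub> g)"])
      show "\<forall>x\<in>E. \<phi> (inv\<^bsub>G\<^esub> g) (\<phi> g x) = x" "\<forall>x\<in>E. \<phi> g (\<phi> (inv\<^bsub>G\<^esub> g) x) = x"
        using g mult[of "inv\<^bsub>G\<^esub> g" g] mult[of g "inv\<^bsub>G\<^esub> g"] one by auto
      show "\<phi> g ` E \<subseteq> E" "\<phi> (inv\<^bsub>G\<^esub> g) ` E \<subseteq> E"
        using g closed by auto
    qed
    then show ?thesis using ext[OF g] by (simp add: Bij_def)
  qed
  have "\<phi> (g \<otimes>\<^bsub>G\<^esub> h) = compose E (\<phi> g) (\<phi> h)"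
    if "g \<in> carrier G" "h \<in> carrier G" for g h
    by (rule extensionalityI[of _ E]) (use that in \<open>auto simp: ext mult compose_def\<close>)
  then have "\<phi> \<in> hom G (BijGroup E)"
    by (auto simp: hom_def BijGroup_def bij)
  then show ?thesis
    by (simp add: group_action_def group_hom_def group_hom_axioms_def group_BijGroup G)
qed

lemma coset_action_is_action:
  assumes "group G" and H: "subgroup H G"
  shows "group_action G (lcosets\<^bsub>G\<^esub> H) (coset_action G H)"
proof -
  interpret group G by fact
  have sub: "H \<subseteq> carrier G" by (rule subgroup.subset[OF H])
  have c: "g <#\<^bsub>G\<^esub> X \<in> lcosets\<^bsub>G\<^esub> H" if "g \<in> carrier G" "X \<in> lcosets\<^bsub>G\<^esub> H" for g X
    using that sub by (auto simp: LCOSETS_def lcos_m_assoc)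
  show ?thesis
    by (rule group_actionI[OF \<open>group G\<close>])
      (use c subgroup.lcosets_carrier[OF H \<open>group G\<close>] in
        \<open>auto simp: coset_action_def lcos_m_assoc lcos_mult_one\<close>)
qed

lemma disjoint_union_action_is_action:
  assumes "group G" and act: "\<And>i. i \<in> I \<Longrightarrow> group_action G (E i) (\<phi> i)"
  shows "group_action G (Sigma I E) (disjoint_union_action I E \<phi>)"
proof (rule group_actionI[OF \<open>group G\<close>])
  interpret group G by fact
  fix g p assume "p \<in> Sigma I E"
  then obtain i x where p: "p = (i, x)" "i \<in> I" "x \<in> E i" by auto
  interpret A: group_action G "E i" "\<phi> i" by (rule act[OF p(2)])
  show "disjoint_union_action I E \<phi> \<one>\<^bsub>G\<^esub> p = p"
    using p fun_cong[OF A.id_eq_one, of x] by (simp add: disjoint_union_action_def)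
  assume g: "g \<in> carrier G"
  show "disjoint_union_action I E \<phi> g p \<in> Sigma I E"
    using p A.element_image[OF g p(3) refl] by (simp add: disjoint_union_action_def)
  fix h assume h: "h \<in> carrier G"
  show "disjoint_union_action I E \<phi> (g \<otimes>\<^bsub>G\<^esub> h) p
      = disjoint_union_action I E \<phi> g (disjoint_union_action I E \<phi> h p)"
    using p A.element_image[OF h p(3) refl] A.composition_rule[OF p(3) g h]
    by (simp add: disjoint_union_action_def)
qed (simp add: disjoint_union_action_def)

lemma subgroup_conj_classesD:
  assumes "group G" "C \<in> subgroup_conj_classes G" "H \<in> C"
  shows "subgroup H G"
  using assms
  by (auto simp: subgroup_conj_classes_def orbits_def orbit_def
      intro: group.subgroup_conjugation_is_surj2)

lemma Sigma_action_is_action: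
  assumes "group G" "\<forall>C \<in> subgroup_conj_classes G. rep C \<in> C"
  shows "group_action G (Sigma_gset G rep) (Sigma_action G rep)"
  unfolding Sigma_gset_def Sigma_action_def
  by (rule disjoint_union_action_is_action[OF assms(1)])
    (use assms in \<open>auto intro: coset_action_is_action subgroup_conj_classesD\<close>)

lemma nontrivial_meet_graph_is_graph:
  assumes "finite V"
  shows "pair_graph (nontrivial_meet_graph G V)"
proof -
  have "finite {(H, K). H \<in> V \<and> K \<in> V \<and> H \<noteq> K \<and> H \<inter> K \<noteq> {\<one>\<^bsub>G\<^esub>}}"
    by (rule finite_subset[of _ "V \<times> V"]) (use assms in auto)
  then show ?thesis
    using assms
    by unfold_locales (auto simp: nontrivial_meet_graph_def symmetric_def sym_def)
qed

end

theory Submission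
  imports Defs
begin

text \<open>
  Both graphs arise from their vertex sets by the same adjacency rule, and the vertices of
  \<open>\<Gamma>[\<Sigma>]\<close> are proper non-trivial subgroups by definition. So everything reduces to finding every
  subgroup \<open>K\<close> of \<open>G\<close> among the point stabilizers of \<open>\<Sigma>\<close>. The stabilizer of the coset \<open>aH\<close> in
  \<open>G/H\<close> is the conjugate \<open>aHa\<^sup>-\<^sup>1\<close> (lemma \<open>stabilizer_l_coset\<close>), so the stabilizers in \<open>G/H\<close> exhaust
  the conjugacy class of \<open>H\<close>. As \<open>\<Sigma>\<close> has a summand \<open>G/H\<close> for every class, all subgroups occur
  (lemma \<open>subgroup_is_stabilizer_in_Sigma\<close>).
\<close>

text \<open>
  \<open>g\<close> fixes \<open>aH\<close> iff \<open>ga\<close> lies in \<open>aH\<close>, because distinct left cosets are disjoint; cancelling \<open>a\<close>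
  on the right turns this into \<open>g \<in> aHa\<^sup>-\<^sup>1\<close>.
\<close>

lemma (in group) stabilizer_l_coset:
  assumes H: "subgroup H G" and a: "a \<in> carrier G"
  shows "stabilizer G (coset_action G H) (a <# H) = a <# H #> inv a"
proof -
  have sub: "H \<subseteq> carrier G" by (rule subgroup.subset[OF H])
  have aH: "a <# H \<in> lcosets H" using a by (auto simp: LCOSETS_def)
  have fixes_iff: "g <# (a <# H) = a <# H \<longleftrightarrow> g \<otimes> a \<in> a <# H" if g: "g \<in> carrier G" for g
    using l_repr_independence[OF _ a H] lcos_self[OF _ H, of "g \<otimes> a"] g a sub
    by (metis lcos_m_assoc m_closed)
  have conj_iff: "g \<otimes> a \<in> a <# H \<longleftrightarrow> g \<in> a <# H #> inv a" if g: "g \<in> carrier G" for g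
  proof
    assume "g \<otimes> a \<in> a <# H"
    moreover have "g = (g \<otimes> a) \<otimes> inv a" using g a by (simp add: m_assoc)
    ultimately show "g \<in> a <# H #> inv a" unfolding r_coset_def by blast
  next
    assume "g \<in> a <# H #> inv a"
    then obtain y where y: "y \<in> a <# H" "g = y \<otimes> inv a" unfolding r_coset_def by blast
    then show "g \<otimes> a \<in> a <# H"
      using a l_coset_carrier[OF y(1) a H] by (simp add: m_assoc)
  qed
  have "a <# H #> inv a \<subseteq> carrier G"
    by (intro r_coset_subset_G l_coset_subset_G sub a inv_closed)
  then show ?thesis
    using aH fixes_iff conj_iff by (auto simp: stabilizer_def coset_action_def)
qed

lemma stabilizer_disjoint_union_action:
  assumes "i \<in> I" "x \<in> E i"
  shows "stabilizer G (disjoint_union_action I E \<phi>) (i, x) = stabilizer G (\<phi> i) x"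
  using assms by (simp add: stabilizer_def disjoint_union_action_def)

text \<open>
  The stabilizer is found in the summand of the class of \<open>K\<close> itself. Conjugacy is used from the
  representative to \<open>K\<close>, so that the conjugating element \<open>a\<close> is the one that names the coset \<open>aH\<close>.
\<close>

lemma (in group) subgroup_is_stabilizer_in_Sigma:
  assumes rep: "\<forall>C \<in> subgroup_conj_classes G. rep C \<in> C" and K: "subgroup K G"
  shows "\<exists>p \<in> Sigma_gset G rep. K = stabilizer G (Sigma_action G rep) p"
proof -
  let ?conj = "\<lambda>g. \<lambda>H \<in> {H. subgroup H G}. g <# H #> inv g"
  interpret conj: group_action G "{H. subgroup H G}" ?conj
    by (rule action_by_conjugation_on_subgroups_set)
  define C where "C = orbit G ?conj K"
  have C: "C \<in> subgroup_conj_classes G"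
    unfolding subgroup_conj_classes_def orbits_def C_def using K by blast
  have H: "subgroup (rep C) G"
    using subgroup_conj_classesD[OF is_group C] rep C by blast
  have "K \<in> orbit G ?conj (rep C)"
    by (rule conj.orbit_sym) (use K H rep C in \<open>auto simp: C_def\<close>)
  then obtain a where a: "a \<in> carrier G" and conj: "K = a <# rep C #> inv a"
    using H by (auto simp: orbit_def)
  have aH: "a <# rep C \<in> lcosets (rep C)" using a by (auto simp: LCOSETS_def)
  have "stabilizer G (Sigma_action G rep) (C, a <# rep C) = K"
    unfolding Sigma_action_def
    using C aH by (simp add: stabilizer_disjoint_union_action stabilizer_l_coset[OF H a] conj)
  moreover have "(C, a <# rep C) \<in> Sigma_gset G rep"
    using C aH by (simp add: Sigma_gset_def)
  ultimately show ?thesis by blast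
qed

theorem proposition6p1:
  fixes G :: "('a, 'm) monoid_scheme"
    and rep :: "'a set set \<Rightarrow> 'a set"
  assumes "group G"
    and "finite (carrier G)"
    and "\<forall>C \<in> subgroup_conj_classes G. rep C \<in> C"
  shows "gset_intersection_graph G (Sigma_gset G rep) (Sigma_action G rep) = intersection_graph G"
proof -
  have "{H \<in> proper_nontrivial_subgroups G.
      \<exists>p \<in> Sigma_gset G rep. H = stabilizer G (Sigma_action G rep) p}
    = proper_nontrivial_subgroups G"
    using group.subgroup_is_stabilizer_in_Sigma[OF assms(1,3)]
    by (auto simp: proper_nontrivial_subgroups_def)
  then show ?thesis
    by (simp add: gset_intersection_graph_def intersection_graph_def)
qed

end
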